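(* Let $n\ge1$, let $\lambda:\mathbb{S}^n\to\mathbb{R}^n$, $\lambda(A)=[\lambda_1(A),\dots,\lambda_n(A)]^T$, where $\lambda_1(A)\ge\dots\ge\lambda_n(A)$ are the ordered eigenvalues of $A$ (with multiplicity), and let $$K_n=\Big\{v\in\mathbb{R}^n : \sum_{i=1}^kv_i\ge0,\ k=1,\dots,n-1,\ \sum_{i=1}^nv_i=0\Big\}.$$ Then the following hold: (a) $K_n$ is closed, convex and pointed with $-K_n^\circ=\{w\in\mathbb{R}^n : w_1\ge\dots\ge w_n\}$. (b) $\lambda$ is $K_n$-convex and $K_n$-closed. (c) The following are equivalent: (i) $K_n\subset-K_n^\circ$; (ii) $n\le2$; (iii) $K_n\text{-}\mathrm{epi}\,\lambda=\overline{\mathrm{conv}}(\mathrm{gph}\,\lambda)$.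
   Context: $\mathbb{S}^n$ is the space of real symmetric $n\times n$ matrices with inner product $\mathrm{tr}(XY)$; $\mathbb{R}^n$ has the standard inner product. A cone $K$ is pointed if $K\cap(-K)=\{0\}$; its polar is $K^\circ:=\{v : \langle u,v\rangle\le0\ \forall u\in K\}$. For a map $F:\mathbb{E}_1\to\mathbb{E}_2$ and a cone $K\subset\mathbb{E}_2$, $K\text{-}\mathrm{epi}\,F:=\{(x,y)\in\mathbb{E}_1\times\mathbb{E}_2 : y-F(x)\in K\}$; $F$ is $K$-convex (resp. $K$-closed) if this set is convex (resp. closed). $\mathrm{gph}$ is the graph and $\overline{\mathrm{conv}}$ the closed convex hull. *)

theory Defs
  imports "HOL-Analysis.Analysis" "HOL-Computational_Algebra.Polynomial"
begin

text \<open>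
  The dimension is \<open>n = CARD('n)\<close>, where the index type \<open>'n\<close> is finite, linearly ordered and
  (like every type) nonempty; its elements in increasing order play the role of \<open>1, \<dots>, n\<close>.
\<close>

text \<open>
  The space of symmetric matrices is a linear subspace of \<open>real^'n^'n\<close>. Since it is closed, a
  subset of it is relatively closed iff it is closed in the ambient space, and likewise for the
  closure. The inherited inner product is the trace inner product, see
  \<open>inner_eq_trace_mult\<close> below.
\<close>

definition sym_matrices :: "(real^'n^'n) set" where
  "sym_matrices = {A. transpose A = A}"

lemma inner_eq_trace_mult:
  fixes X Y :: "real^'n^'n"
  assumes "X \<in> sym_matrices"
  shows "X \<bullet> Y = trace (X ** Y)"
proof -
  have sym: "X $ j $ i = X $ i $ j" for i j
    using assms by (metis (mono_tags) mem_Collect_eq sym_matrices_def transpose_def vec_lambda_beta)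
  have "X \<bullet> Y = (\<Sum>i\<in>UNIV. \<Sum>j\<in>UNIV. X $ i $ j * Y $ i $ j)"
    by (simp add: inner_vec_def)
  also have "\<dots> = (\<Sum>j\<in>UNIV. \<Sum>i\<in>UNIV. X $ j $ i * Y $ i $ j)"
    by (subst sum.swap) (simp add: sym)
  also have "\<dots> = trace (X ** Y)"
    by (simp add: trace_def matrix_matrix_mult_def)
  finally show ?thesis .
qed

definition charpoly :: "real^'n^'n \<Rightarrow> real poly" where
  "charpoly A = det (mat [:0, 1:] - (\<chi> i j. [:A $ i $ j:]))"

text \<open>The eigenvalues are exactly the roots of \<open>charpoly A\<close>:\<close>

lemma poly_charpoly: "poly (charpoly A) x = det (mat x - A)"
  unfolding charpoly_def det_def
  by (auto simp: poly_sum poly_prod mat_def of_int_poly intro!: sum.cong prod.cong)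

lemma charpoly_root_iff_eigenvalue:
  fixes A :: "real^'n^'n"
  shows "poly (charpoly A) x = 0 \<longleftrightarrow> (\<exists>v. v \<noteq> 0 \<and> A *v v = x *\<^sub>R v)"
proof -
  have "(mat x - A) *v v = x *\<^sub>R v - A *v v" for v
  proof -
    have "mat x = x *\<^sub>R (mat 1 :: real^'n^'n)"
      by (simp add: mat_def vec_eq_iff)
    then show ?thesis
      by (simp add: matrix_vector_mult_diff_rdistrib scaleR_matrix_vector_assoc [symmetric])
  qed
  then have "(\<exists>v. v \<noteq> 0 \<and> A *v v = x *\<^sub>R v) \<longleftrightarrow> (\<exists>v. v \<noteq> 0 \<and> (mat x - A) *v v = 0)"
    by (metis right_minus_eq)
  also have "\<dots> \<longleftrightarrow> det (mat x - A) = 0"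
    by (metis invertible_det_nz invertible_left_inverse matrix_left_invertible_ker matrix_vector_mult_0_right)
  finally show ?thesis by (simp add: poly_charpoly)
qed

definition antitone_vecs :: "(real^'n::{finite,linorder}) set" where
  "antitone_vecs = {w. \<forall>i j. i \<le> j \<longrightarrow> w $ j \<le> w $ i}"

text \<open>
  The nonincreasing vector in which every \<open>x\<close> occurs as often as its multiplicity as an
  eigenvalue of \<open>A\<close>. It is well defined on symmetric matrices, the only ones on which it is used.
\<close>

definition ordered_eigenvalues :: "real^('n::_)^('n::{finite,linorder}) \<Rightarrow> real^('n::_)" where
  "ordered_eigenvalues A =
     (THE w. w \<in> antitone_vecs \<and> (\<forall>x. card {i. w $ i = x} = order x (charpoly A)))"

definition eig_cone :: "(real^'n::{finite,linorder}) set" where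
  "eig_cone = {v. (\<forall>k < Max UNIV. (\<Sum>i | i \<le> k. v $ i) \<ge> 0) \<and> (\<Sum>i\<in>UNIV. v $ i) = 0}"

definition pointed_cone :: "'a::real_vector set \<Rightarrow> bool" where
  "pointed_cone K \<longleftrightarrow> cone K \<and> K \<inter> uminus ` K = {0}"

definition polar :: "'a::real_inner set \<Rightarrow> 'a set" where
  "polar K = {v. \<forall>u\<in>K. u \<bullet> v \<le> 0}"

text \<open>Epigraph and graph of \<open>F\<close> restricted to the domain \<open>S\<close>.\<close>

definition K_epi :: "'b::real_vector set \<Rightarrow> 'a set \<Rightarrow> ('a \<Rightarrow> 'b) \<Rightarrow> ('a \<times> 'b) set" where
  "K_epi K S F = {(x, y). x \<in> S \<and> y - F x \<in> K}"

definition gph :: "'a set \<Rightarrow> ('a \<Rightarrow> 'b) \<Rightarrow> ('a \<times> 'b) set" where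
  "gph S F = {(x, y). x \<in> S \<and> y = F x}"

definition K_convex :: "'b::real_vector set \<Rightarrow> 'a::real_vector set \<Rightarrow> ('a \<Rightarrow> 'b) \<Rightarrow> bool" where
  "K_convex K S F \<longleftrightarrow> convex (K_epi K S F)"

definition K_closed ::
  "'b::real_normed_vector set \<Rightarrow> 'a::real_normed_vector set \<Rightarrow> ('a \<Rightarrow> 'b) \<Rightarrow> bool" where
  "K_closed K S F \<longleftrightarrow> closed (K_epi K S F)"

end

theory Submission
  imports Defs
begin

text \<open>
  For a symmetric matrix with ordered eigenvalues \<open>w\<close>, Ky Fan's principle says that the sum of the
  first \<open>k\<close> entries of \<open>w\<close> is the maximum of \<open>\<Sum>i\<le>k. q i \<bullet> (A *v q i)\<close> over all orthonormal bases
  \<open>q\<close>, while the sum over all of \<open>q\<close> does not depend on \<open>q\<close>. Membership of \<open>y - w\<close> in the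
  cone compares exactly these partial sums with those of \<open>y\<close>, so the epigraph is an intersection of
  closed half-spaces and hyperplanes in \<open>(A, y)\<close>; this gives convexity and closedness at once
  (\<open>K_epi_ordered_eigenvalues\<close>). Ky Fan's principle rests on the spectral theorem
  (\<open>ordered_eigenbasis_exists\<close>), which also shows that the characteristic polynomial splits and hence
  that the ordered eigenvalues are well defined (\<open>ordered_eigenvalues_eqI\<close>).

  The dual of the cone is found by summation by parts: a nonincreasing \<open>w\<close> pairs nonnegatively
  with every vector whose partial sums are nonnegative and whose total is zero, and conversely the
  vectors \<open>axis i 1 - axis j 1\<close> with \<open>i \<le> j\<close> lie in the cone and force \<open>w\<close> to be nonincreasing.

  For the equivalences, the eigenvalue vectors all lie in the closed convex set of nonincreasing
  vectors, so the closed convex hull of the graph does too; but the fibre of the epigraph over the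
  zero matrix is the whole cone. Equality therefore forces the cone to consist of nonincreasing
  vectors, which fails as soon as there is an index strictly between the extreme ones. In dimension
  two a pair \<open>(A, y)\<close> of the epigraph is the midpoint of two points of the graph, obtained by
  spreading the eigenvalues of \<open>A\<close> apart in its own eigenbasis in the two opposite directions
  (\<open>K_epi_subset_hull_gph\<close>).
\<close>

section \<open>Orthonormal families of vectors\<close>

definition orthonormal :: "('n \<Rightarrow> real^'n) \<Rightarrow> bool" where
  "orthonormal u \<longleftrightarrow> (\<forall>i j. u i \<bullet> u j = (if i = j then 1 else 0))"

definition matrix_of_columns :: "('n \<Rightarrow> real^'n) \<Rightarrow> real^'n^'n" where
  "matrix_of_columns u = (\<chi> a i. u i $ a)"

lemma orthonormal_axis: "orthonormal (\<lambda>i. axis i 1)"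
  by (auto simp: orthonormal_def inner_axis_axis)

lemma orthonormal_comp_inj:
  assumes "orthonormal u" "inj p"
  shows "orthonormal (u \<circ> p)"
  using assms by (auto simp: orthonormal_def inj_eq)

lemma orthogonal_matrix_of_columns:
  assumes "orthonormal u"
  shows "orthogonal_matrix (matrix_of_columns u)"
  using assms
  by (simp add: orthogonal_matrix vec_eq_iff matrix_matrix_mult_def transpose_def mat_def
      matrix_of_columns_def orthonormal_def inner_vec_def)

text \<open>
  A square matrix with orthonormal columns also has orthonormal rows; the second fact is the
  completeness of the family.
\<close>

lemma orthonormal_expansion:
  assumes "orthonormal u"
  shows "x = (\<Sum>j\<in>UNIV. (u j \<bullet> x) *\<^sub>R u j)"
proof -
  let ?Q = "matrix_of_columns u"
  have "?Q ** transpose ?Q = mat 1"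
    using orthogonal_matrix_of_columns[OF assms] by (simp add: orthogonal_matrix_def)
  then have "x = ?Q *v (transpose ?Q *v x)"
    by (metis matrix_vector_mul_assoc matrix_vector_mul_lid)
  also have "transpose ?Q *v x = (\<chi> j. u j \<bullet> x)"
    by (simp add: vec_eq_iff matrix_vector_mult_def transpose_def matrix_of_columns_def inner_vec_def)
  also have "?Q *v (\<chi> j. u j \<bullet> x) = (\<Sum>j\<in>UNIV. (u j \<bullet> x) *\<^sub>R u j)"
    by (simp add: vec_eq_iff matrix_vector_mult_def matrix_of_columns_def mult.commute)
  finally show ?thesis .
qed

lemma orthonormal_parseval:
  assumes "orthonormal u"
  shows "(\<Sum>j\<in>UNIV. (u j \<bullet> x)\<^sup>2) = x \<bullet> x"
proof -
  have "x \<bullet> x = (\<Sum>j\<in>UNIV. (u j \<bullet> x) *\<^sub>R u j) \<bullet> x"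
    using orthonormal_expansion[OF assms, of x] by simp
  then show ?thesis
    by (simp add: inner_sum_left power2_eq_square)
qed

lemma matrix_eqI_orthonormal:
  assumes "orthonormal u" "\<And>j. A *v u j = B *v u j"
  shows "A = B"
proof -
  have "A *v x = B *v x" for x
  proof -
    have "A *v (\<Sum>j\<in>UNIV. (u j \<bullet> x) *\<^sub>R u j) = B *v (\<Sum>j\<in>UNIV. (u j \<bullet> x) *\<^sub>R u j)"
      by (simp add: matrix_vector_mult_scaleR assms(2)
          linear_sum[OF matrix_vector_mul_linear])
    then show ?thesis
      using orthonormal_expansion[OF assms(1), of x] by simp
  qed
  then show ?thesis by (simp add: matrix_eq)
qed

section \<open>Spectral theorem\<close>

lemma sym_matrices_inner:
  assumes "A \<in> sym_matrices"
  shows "x \<bullet> (A *v y) = (A *v x) \<bullet> y"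
  using assms by (metis (mono_tags, lifting) dot_lmul_matrix mem_Collect_eq sym_matrices_def
      vector_transpose_matrix)

text \<open>
  For small \<open>t\<close> of the sign of \<open>a\<close> the linear term dominates.
\<close>

lemma linear_term_zero_if_quadratic_nonpos:
  fixes a c :: real
  assumes "\<And>t. 2 * t * a + t\<^sup>2 * c \<le> 0"
  shows "a = 0"
proof (rule ccontr)
  assume "a \<noteq> 0"
  define t where "t = a / (\<bar>c\<bar> + 1)"
  have a: "a = t * (\<bar>c\<bar> + 1)" by (simp add: t_def)
  have "t \<noteq> 0" using \<open>a \<noteq> 0\<close> a by auto
  have "2 * t * a + t\<^sup>2 * c = t\<^sup>2 * (2 * \<bar>c\<bar> + 2 + c)"
    unfolding a by (simp add: power2_eq_square algebra_simps)
  also have "\<dots> > 0"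
    using \<open>t \<noteq> 0\<close> by (intro mult_pos_pos) auto
  finally show False using assms[of t] by simp
qed

text \<open>
  A maximiser \<open>x\<close> of the Rayleigh quotient on the unit sphere of the subspace is an eigenvector:
  its residual \<open>r = A *v x - m *\<^sub>R x\<close> stays in the subspace, and moving \<open>x\<close> along \<open>r\<close> would
  increase the quotient to first order unless \<open>r = 0\<close>.
\<close>

lemma eigenvector_in_invariant_subspace:
  fixes A :: "real^'n^'n"
  assumes A: "A \<in> sym_matrices" and V: "subspace V" and inv: "\<And>x. x \<in> V \<Longrightarrow> A *v x \<in> V"
    and nz: "x0 \<in> V" "x0 \<noteq> 0"
  obtains x m where "x \<in> V" "norm x = 1" "A *v x = m *\<^sub>R x"
proof -
  let ?S = "sphere 0 1 \<inter> V" and ?f = "\<lambda>x. x \<bullet> (A *v x)"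
  have "compact ?S" using V by (simp add: closed_subspace compact_Int_closed)
  moreover have "x0 /\<^sub>R norm x0 \<in> ?S" using nz V by (auto simp: subspace_scale)
  moreover have "continuous_on ?S ?f"
    by (intro continuous_intros linear_continuous_on matrix_vector_mul_bounded_linear)
  ultimately obtain x where x: "x \<in> ?S" and max: "\<And>y. y \<in> ?S \<Longrightarrow> ?f y \<le> ?f x"
    using continuous_attains_sup[of ?S ?f] by blast
  define m where "m = ?f x"
  have max': "?f y \<le> m * (y \<bullet> y)" if "y \<in> V" for y
  proof (cases "y = 0")
    case False
    have "?f (y /\<^sub>R norm y) \<le> m"
      unfolding m_def using that False V by (intro max) (auto simp: subspace_scale)
    also have "?f (y /\<^sub>R norm y) = ?f y / (y \<bullet> y)"
      by (simp add: matrix_vector_mult_scaleR dot_square_norm power2_eq_square divide_simps)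
    finally show ?thesis using False by (simp add: divide_simps split: if_splits)
  qed simp
  define r where "r = A *v x - m *\<^sub>R x"
  have rV: "r \<in> V" unfolding r_def using x V inv by (auto intro: subspace_diff subspace_scale)
  have xx: "x \<bullet> x = 1" using x by (simp add: dot_square_norm)
  \<comment> \<open>The first variation of the Rayleigh quotient at \<open>x\<close> in the direction of its own residual.\<close>
  have "2 * t * (r \<bullet> r) + t\<^sup>2 * (?f r - m * (r \<bullet> r)) \<le> 0" for t
  proof -
    have le: "?f (x + t *\<^sub>R r) \<le> m * ((x + t *\<^sub>R r) \<bullet> (x + t *\<^sub>R r))"
      using x rV V by (intro max') (auto intro: subspace_add subspace_scale)
    have f: "?f (x + t *\<^sub>R r) = m + 2 * t * (r \<bullet> (A *v x)) + t\<^sup>2 * ?f r"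
      using sym_matrices_inner[OF A, of x r]
      by (simp add: m_def matrix_vector_right_distrib matrix_vector_mult_scaleR inner_add_left
          inner_add_right power2_eq_square algebra_simps inner_commute)
    have n: "(x + t *\<^sub>R r) \<bullet> (x + t *\<^sub>R r) = 1 + 2 * t * (r \<bullet> x) + t\<^sup>2 * (r \<bullet> r)"
      using xx by (simp add: inner_add_left inner_add_right power2_eq_square inner_commute)
    have ax: "r \<bullet> (A *v x) = r \<bullet> r + m * (r \<bullet> x)"
      by (simp add: r_def inner_diff_left inner_diff_right inner_commute algebra_simps)
    show ?thesis using le unfolding f n ax by (simp add: algebra_simps)
  qed
  then have "r \<bullet> r = 0" by (rule linear_term_zero_if_quadratic_nonpos)
  then have "A *v x = m *\<^sub>R x" by (simp add: r_def)
  then show ?thesis using that x by auto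
qed

text \<open>
  An orthonormal set of eigenvectors of largest size is a basis: otherwise its orthogonal complement
  is a nonzero invariant subspace and contributes one more eigenvector.
\<close>

lemma orthonormal_eigenvector_set:
  fixes A :: "real^'n^'n"
  assumes A: "A \<in> sym_matrices"
  obtains B where "finite B" "card B = CARD('n)" "pairwise orthogonal B"
    "\<And>b. b \<in> B \<Longrightarrow> norm b = 1" "\<And>b. b \<in> B \<Longrightarrow> \<exists>m. A *v b = m *\<^sub>R b"
proof -
  define P where "P B \<longleftrightarrow> pairwise orthogonal B \<and> (\<forall>b\<in>B. norm b = 1 \<and> (\<exists>m. A *v b = m *\<^sub>R b))"
    for B :: "(real^'n) set"
  have indep: "independent B" if "P B" for B
    using that by (intro pairwise_orthogonal_independent) (auto simp: P_def)
  have bound: "finite B \<and> card B \<le> CARD('n)" if "P B" for B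
    using independent_bound[OF indep[OF that]] by simp
  have "P {}" by (simp add: P_def)
  moreover have "\<forall>B. P B \<longrightarrow> card B < Suc (CARD('n))"
    using bound by (simp add: less_Suc_eq_le)
  ultimately obtain B where B: "P B" and max: "\<And>C. P C \<Longrightarrow> card C \<le> card B"
    using ex_has_greatest_nat[of P "{}" card] by blast
  have "card B = CARD('n)"
  proof (rule ccontr)
    assume "card B \<noteq> CARD('n)"
    then have "dim B < DIM(real^'n)"
      using bound[OF B] indep[OF B] by (simp add: dim_eq_card_independent)
    then obtain x0 where x0: "x0 \<noteq> 0" "\<And>y. y \<in> span B \<Longrightarrow> orthogonal x0 y"
      using orthogonal_to_subspace_exists by blast
    define V where "V = {x. \<forall>b\<in>B. orthogonal x b}"
    have "subspace V"
      by (auto simp: V_def subspace_def orthogonal_def inner_add_left)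
    moreover have "A *v x \<in> V" if "x \<in> V" for x
    proof -
      have "(A *v x) \<bullet> b = 0" if "b \<in> B" for b
      proof -
        obtain m where "A *v b = m *\<^sub>R b" using B \<open>b \<in> B\<close> by (auto simp: P_def)
        then show ?thesis
          using \<open>x \<in> V\<close> \<open>b \<in> B\<close> by (simp flip: sym_matrices_inner[OF A] add: V_def orthogonal_def)
      qed
      then show ?thesis by (simp add: V_def orthogonal_def)
    qed
    moreover have "x0 \<in> V" using x0 by (auto simp: V_def span_base)
    ultimately obtain x m where x: "x \<in> V" "norm x = 1" "A *v x = m *\<^sub>R x"
      using eigenvector_in_invariant_subspace[OF A] x0(1) by metis
    have "P (insert x B)"
      using B x by (auto simp: P_def V_def pairwise_insert orthogonal_commute)
    moreover have "x \<notin> B"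
      using x by (auto simp: V_def orthogonal_def dot_square_norm)
    ultimately show False
      using max[of "insert x B"] bound[OF B] by simp
  qed
  then show ?thesis using that B bound[OF B] by (auto simp: P_def)
qed

text \<open>
  Sort \<open>B\<close> by decreasing \<open>f\<close> and assign to an index the list entry whose position is the number of
  smaller indices.
\<close>

lemma antitone_enumeration:
  fixes f :: "'a \<Rightarrow> real"
  assumes "finite B" "card B = CARD('n::{finite,linorder})"
  obtains u :: "'n::{finite,linorder} \<Rightarrow> 'a"
  where "bij_betw u UNIV B" "\<And>i j. i \<le> j \<Longrightarrow> f (u j) \<le> f (u i)"
proof -
  obtain bs where bs: "set bs = B" "distinct bs"
    using finite_distinct_list[OF assms(1)] by blast
  define xs where "xs = sort_key (\<lambda>b. - f b) bs"
  have xs: "set xs = B" "distinct xs" "sorted (map (\<lambda>b. - f b) xs)"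
    using bs by (simp_all add: xs_def)
  have len: "length xs = CARD('n)"
    using distinct_card[OF xs(2)] xs(1) assms(2) by simp
  define r :: "'n \<Rightarrow> nat" where "r i = card {..<i}" for i
  have r_less: "r i < r j" if "i < j" for i j
    unfolding r_def using that by (intro psubset_card_mono) auto
  have r_bound: "r i < CARD('n)" for i
    unfolding r_def by (intro psubset_card_mono) auto
  have "inj r"
    by (rule injI) (metis less_irrefl linorder_neqE r_less)
  moreover have "range r = {..<CARD('n)}"
    using r_bound card_image[OF \<open>inj r\<close>] by (intro card_subset_eq) auto
  ultimately have "bij_betw r UNIV {..<length xs}"
    by (simp add: bij_betw_def len)
  then have "bij_betw ((!) xs \<circ> r) UNIV B"
    using bij_betw_nth[OF xs(2) refl xs(1)[symmetric]] bij_betw_trans by blast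
  moreover have "f (((!) xs \<circ> r) j) \<le> f (((!) xs \<circ> r) i)" if "i \<le> j" for i j
  proof -
    have "r i \<le> r j" using that r_less by (metis order_le_less)
    then show ?thesis
      using sorted_nth_mono[OF xs(3), of "r i" "r j"] r_bound[of j] r_bound[of i] len by simp
  qed
  ultimately show ?thesis using that by blast
qed

lemma ordered_eigenbasis_exists:
  fixes A :: "real^('n::_)^('n::{finite,linorder})"
  assumes A: "A \<in> sym_matrices"
  obtains w u where "w \<in> antitone_vecs" "orthonormal u" "\<And>i. A *v u i = (w $ i) *\<^sub>R u i"
proof -
  obtain B where B: "finite B" "card B = CARD('n)" "pairwise orthogonal B"
    "\<And>b. b \<in> B \<Longrightarrow> norm b = 1" "\<And>b. b \<in> B \<Longrightarrow> \<exists>m. A *v b = m *\<^sub>R b"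
    using orthonormal_eigenvector_set[OF A] by metis
  then obtain f where f: "\<And>b. b \<in> B \<Longrightarrow> A *v b = f b *\<^sub>R b" by metis
  obtain u :: "'n \<Rightarrow> _" where u: "bij_betw u UNIV B" "\<And>i j. i \<le> j \<Longrightarrow> f (u j) \<le> f (u i)"
    using antitone_enumeration[OF B(1,2), of f] by metis
  have uB: "u i \<in> B" for i using u(1) by (auto simp: bij_betw_def)
  have uj: "u i = u j \<longleftrightarrow> i = j" for i j using u(1) by (auto simp: bij_betw_def inj_def)
  have "orthonormal u"
    using B(3,4) uB uj unfolding orthonormal_def pairwise_def orthogonal_def
    by (auto simp: dot_square_norm)
  moreover have "(\<chi> i. f (u i)) \<in> antitone_vecs"
    using u(2) by (simp add: antitone_vecs_def)
  ultimately show ?thesis using that f uB by (metis vec_lambda_beta)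
qed

section \<open>Ordered eigenvalues\<close>

text \<open>
  With \<open>Q\<close> the matrix of eigenvectors and \<open>D\<close> the diagonal matrix of the numbers \<open>x - w $ i\<close>, we have
  \<open>(mat x - A) ** Q = Q ** D\<close>, and \<open>det Q\<close> cancels.
\<close>

lemma charpoly_eigenbasis:
  fixes A :: "real^'n^'n"
  assumes u: "orthonormal u" "\<And>i. A *v u i = (w $ i) *\<^sub>R u i"
  shows "charpoly A = (\<Prod>i\<in>UNIV. [:- w $ i, 1:])"
proof -
  let ?Q = "matrix_of_columns u"
  have "poly (charpoly A) x = poly (\<Prod>i\<in>UNIV. [:- w $ i, 1:]) x" for x
  proof -
    define D :: "real^'n^'n" where "D = (\<chi> i j. if i = j then x - w $ i else 0)"
    have A': "(\<Sum>k\<in>UNIV. A $ i $ k * u j $ k) = w $ j * u j $ i" for i j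
      using u(2)[of j] by (simp add: vec_eq_iff matrix_vector_mult_def)
    have "((mat x - A) ** ?Q) $ i $ j = (?Q ** D) $ i $ j" for i j
    proof -
      have "((mat x - A) ** ?Q) $ i $ j
          = (\<Sum>k\<in>UNIV. (if i = k then x * u j $ k else 0) - A $ i $ k * u j $ k)"
        unfolding matrix_matrix_mult_def matrix_of_columns_def mat_def
        by (auto simp: algebra_simps intro!: sum.cong)
      also have "\<dots> = (x - w $ j) * u j $ i"
        by (simp add: sum_subtractf A' left_diff_distrib)
      also have "\<dots> = (?Q ** D) $ i $ j"
        by (simp add: matrix_matrix_mult_def matrix_of_columns_def D_def if_distrib mult.commute
            cong: if_cong)
      finally show ?thesis .
    qed
    then have "(mat x - A) ** ?Q = ?Q ** D" by (simp add: vec_eq_iff)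
    then have "det (mat x - A) * det ?Q = det ?Q * det D" by (metis det_mul)
    moreover have "det ?Q \<noteq> 0"
      using det_orthogonal_matrix[OF orthogonal_matrix_of_columns[OF u(1)]] by auto
    moreover have "det D = (\<Prod>i\<in>UNIV. x - w $ i)"
      by (subst det_diagonal) (auto simp: D_def)
    ultimately show ?thesis by (simp add: poly_charpoly poly_prod)
  qed
  then show ?thesis by (simp add: poly_eq_poly_eq_iff[symmetric] fun_eq_iff)
qed

lemma order_prod_linear_factors:
  fixes w :: "'i \<Rightarrow> 'a::field"
  assumes "finite I"
  shows "order x (\<Prod>i\<in>I. [:- w i, 1:]) = card {i\<in>I. w i = x}"
  using assms
proof (induction I)
  case (insert k I)
  have "order x [:- w k, 1:] = (if w k = x then 1 else 0)"
    using order_power_n_n[of x 1] by (auto intro: order_0I)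
  moreover have "{i \<in> insert k I. w i = x} = (if w k = x then insert k else id) {i\<in>I. w i = x}"
    by auto
  moreover have "(\<Prod>i\<in>insert k I. [:- w i, 1:]) \<noteq> 0"
    using insert.hyps by (simp add: pCons_eq_0_iff del: mult_pCons_left)
  ultimately show ?case
    using insert by (simp add: order_mult del: mult_pCons_left)
qed simp

text \<open>
  The superlevel sets of a nonincreasing vector are initial segments of the index set, so their
  sizes determine the vector; the sizes are sums of the given multiplicities.
\<close>

lemma antitone_vec_eqI:
  fixes v w :: "real^'n::{finite,linorder}"
  assumes "v \<in> antitone_vecs" "w \<in> antitone_vecs"
    and eq: "\<And>x. card {i. v $ i = x} = card {i. w $ i = x}"
  shows "v = w"
proof -
  have count: "card {i. v $ i > t} = card {i. w $ i > t}" for t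
  proof -
    let ?T = "{x. x \<in> range (($) v) \<union> range (($) w) \<and> x > t}"
    have split: "card {i. z $ i > t} = (\<Sum>x\<in>?T. card {i. z $ i = x})"
      if "z = v \<or> z = w" for z
    proof -
      have "{i. z $ i > t} = (\<Union>x\<in>?T. {i. z $ i = x})" using that by auto
      then show ?thesis by (simp only:) (rule card_UN_disjoint, auto)
    qed
    then show ?thesis using eq by simp
  qed
  have "a $ k \<le> b $ k"
    if a: "a \<in> antitone_vecs" and b: "b \<in> antitone_vecs"
      and c: "\<And>t. card {i. a $ i > t} = card {i. b $ i > t}" for a b :: "(real, 'n) vec" and k
  proof (rule ccontr)
    assume "\<not> a $ k \<le> b $ k"
    then have "{..k} \<subseteq> {i. a $ i > b $ k}"
      using a by (auto simp: antitone_vecs_def not_le intro: less_le_trans)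
    moreover have "{i. b $ i > b $ k} \<subseteq> {..<k}"
      using b by (auto simp: antitone_vecs_def simp flip: not_le)
    ultimately have "card {..k} \<le> card {..<k}"
      using c[of "b $ k"] card_mono[of "{i. a $ i > b $ k}" "{..k}"]
        card_mono[of "{..<k}" "{i. b $ i > b $ k}"] by simp
    moreover have "card {..<k} < card {..k}" by (intro psubset_card_mono) auto
    ultimately show False by simp
  qed
  from this[of v w] this[of w v] assms count show ?thesis
    by (simp add: vec_eq_iff order_antisym)
qed

lemma ordered_eigenvalues_eqI:
  fixes A :: "real^('n::_)^('n::{finite,linorder})"
  assumes "orthonormal u" "\<And>i. A *v u i = (w $ i) *\<^sub>R u i" "w \<in> antitone_vecs"
  shows "ordered_eigenvalues A = w"
  unfolding ordered_eigenvalues_def charpoly_eigenbasis[OF assms(1,2)]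
    order_prod_linear_factors[OF finite]
  using assms(3) by (intro the_equality) (auto intro: antitone_vec_eqI)

lemma ordered_eigenbasis:
  fixes A :: "real^('n::_)^('n::{finite,linorder})"
  assumes "A \<in> sym_matrices"
  obtains u where "orthonormal u" "\<And>i. A *v u i = (ordered_eigenvalues A $ i) *\<^sub>R u i"
  using ordered_eigenbasis_exists[OF assms] ordered_eigenvalues_eqI by metis

lemma ordered_eigenvalues_antitone:
  fixes A :: "real^('n::_)^('n::{finite,linorder})"
  assumes "A \<in> sym_matrices"
  shows "ordered_eigenvalues A \<in> antitone_vecs"
  using ordered_eigenbasis_exists[OF assms] ordered_eigenvalues_eqI by metis

section \<open>The cone and its polar\<close>

lemma atMost_Max_UNIV: "{i. i \<le> Max (UNIV :: 'n::{finite,linorder} set)} = UNIV"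
  by auto

text \<open>
  The total sum is the partial sum up to the largest index, so the strict bound on \<open>k\<close> can be dropped.
\<close>

lemma eig_cone_iff:
  fixes v :: "real^'n::{finite,linorder}"
  shows "v \<in> eig_cone \<longleftrightarrow> (\<forall>k. 0 \<le> (\<Sum>i | i \<le> k. v $ i)) \<and> (\<Sum>i\<in>UNIV. v $ i) = 0"
proof -
  have "0 \<le> (\<Sum>i | i \<le> k. v $ i)" if "v \<in> eig_cone" for k
    using that by (cases "k = Max UNIV") (auto simp: eig_cone_def order_less_le)
  then show ?thesis by (auto simp: eig_cone_def)
qed

lemma linear_sum_components: "linear (\<lambda>v :: real^'n. \<Sum>i\<in>I. v $ i)"
  by (intro linear_compose_sum ballI) (simp add: linear_iff)

lemma eig_cone_Inter:
  "(eig_cone :: (real^'n::{finite,linorder}) set) =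
    (\<Inter>k. (\<lambda>v. \<Sum>i | i \<le> k. v $ i) -` {0..}) \<inter> (\<lambda>v. \<Sum>i\<in>UNIV. v $ i) -` {0}"
  by (auto simp: eig_cone_iff)

lemma closed_eig_cone: "closed (eig_cone :: (real^'n::{finite,linorder}) set)"
  unfolding eig_cone_Inter
  by (intro closed_Int closed_INT ballI closed_vimage linear_continuous_on continuous_intros
      linear_conv_bounded_linear[THEN iffD1] linear_sum_components)

lemma convex_eig_cone: "convex (eig_cone :: (real^'n::{finite,linorder}) set)"
  unfolding eig_cone_Inter
  by (intro convex_Int convex_INT convex_linear_vimage linear_sum_components) auto

lemma eq_zero_if_partial_sums_zero:
  fixes v :: "real^'n::{finite,linorder}"
  assumes "\<And>k. (\<Sum>i | i \<le> k. v $ i) = 0"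
  shows "v = 0"
proof -
  have "v $ k = 0" for k
  proof (induction "card {..<k}" arbitrary: k rule: less_induct)
    case less
    have "v $ i = 0" if "i < k" for i
      using that by (intro less psubset_card_mono) auto
    then have "(\<Sum>i\<in>{..<k}. v $ i) = 0" by simp
    moreover have "{i. i \<le> k} = insert k {..<k}" by auto
    ultimately show ?case using assms[of k] by simp
  qed
  then show ?thesis by (simp add: vec_eq_iff)
qed

lemma pointed_eig_cone: "pointed_cone (eig_cone :: (real^'n::{finite,linorder}) set)"
proof -
  have "v = 0" if "v \<in> eig_cone" "- v \<in> eig_cone" for v :: "(real, 'n) vec"
  proof (rule eq_zero_if_partial_sums_zero)
    fix k
    have "0 \<le> (\<Sum>i | i \<le> k. v $ i)" "0 \<le> (\<Sum>i | i \<le> k. (- v) $ i)"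
      using that by (auto simp: eig_cone_iff)
    then show "(\<Sum>i | i \<le> k. v $ i) = 0" by (simp add: sum_negf)
  qed
  moreover have "cone (eig_cone :: (real, 'n) vec set)"
    by (auto simp: cone_def eig_cone_iff simp flip: sum_distrib_left)
  moreover have "(0 :: (real, 'n) vec) \<in> eig_cone" by (simp add: eig_cone_iff)
  ultimately show ?thesis
    by (force simp: pointed_cone_def image_iff)
qed

text \<open>
  Passing from \<open>k\<close> to its successor, the weight on the nonnegative partial sum up to \<open>k\<close> can only
  decrease.
\<close>

lemma summation_by_parts_antitone:
  fixes v w :: "real^'n::{finite,linorder}"
  assumes w: "w \<in> antitone_vecs" and v: "\<And>k. 0 \<le> (\<Sum>i | i \<le> k. v $ i)"
  shows "w $ k * (\<Sum>i | i \<le> k. v $ i) \<le> (\<Sum>i | i \<le> k. v $ i * w $ i)"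
proof (induction "card {..<k}" arbitrary: k rule: less_induct)
  case less
  have k: "{i. i \<le> k} = insert k {..<k}" by auto
  show ?case
  proof (cases "{..<k} = {}")
    case True
    then show ?thesis unfolding k by simp
  next
    case False
    \<comment> \<open>The immediate predecessor of \<open>k\<close>.\<close>
    define p where "p = Max {..<k}"
    have "p \<in> {..<k}" unfolding p_def using False by (intro Max_in) auto
    then have pk: "p < k" by simp
    have p: "{..<k} = {i. i \<le> p}"
      using pk Max_ge[of "{..<k}"] by (auto simp: p_def)
    have "w $ k * (\<Sum>i | i \<le> p. v $ i) \<le> w $ p * (\<Sum>i | i \<le> p. v $ i)"
      using w pk v by (intro mult_right_mono) (auto simp: antitone_vecs_def)
    also have "\<dots> \<le> (\<Sum>i | i \<le> p. v $ i * w $ i)"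
      using pk by (intro less psubset_card_mono) auto
    finally show ?thesis
      unfolding k using p[symmetric] by (simp add: algebra_simps)
  qed
qed

lemma axis_diff_in_eig_cone:
  fixes i j :: "'n::{finite,linorder}"
  assumes "i \<le> j"
  shows "axis i 1 - axis j 1 \<in> eig_cone"
proof -
  have "(\<Sum>m\<in>I. (axis l 1 :: (real, 'n) vec) $ m) = (if l \<in> I then 1 else 0)" for l and I :: "'n set"
    by (simp add: axis_def)
  then show ?thesis using assms by (auto simp: eig_cone_iff sum_subtractf)
qed

lemma uminus_polar_iff: "w \<in> uminus ` polar K \<longleftrightarrow> (\<forall>u\<in>K. 0 \<le> u \<bullet> w)"
proof
  assume "\<forall>u\<in>K. 0 \<le> u \<bullet> w"
  then have "- w \<in> polar K" by (simp add: polar_def)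
  then show "w \<in> uminus ` polar K" by (metis image_eqI minus_minus)
qed (auto simp: polar_def)

lemma uminus_polar_eig_cone:
  "uminus ` polar (eig_cone :: (real^'n::{finite,linorder}) set) = antitone_vecs"
proof (rule set_eqI)
  fix w :: "(real, 'n) vec"
  show "w \<in> uminus ` polar eig_cone \<longleftrightarrow> w \<in> antitone_vecs"
  proof
    assume "w \<in> uminus ` polar eig_cone"
    then have "0 \<le> (axis i 1 - axis j 1) \<bullet> w" if "i \<le> j" for i j
      using axis_diff_in_eig_cone[OF that] by (simp add: uminus_polar_iff)
    then show "w \<in> antitone_vecs"
      by (simp add: antitone_vecs_def inner_diff_left inner_axis')
  next
    assume w: "w \<in> antitone_vecs"
    have "0 \<le> v \<bullet> w" if "v \<in> eig_cone" for v
      using summation_by_parts_antitone[OF w, of v "Max UNIV"] that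
      by (simp add: eig_cone_iff atMost_Max_UNIV inner_vec_def)
    then show "w \<in> uminus ` polar eig_cone" by (simp add: uminus_polar_iff)
  qed
qed

lemma closed_antitone_vecs: "closed (antitone_vecs :: (real^'n::{finite,linorder}) set)"
  unfolding antitone_vecs_def
  by (intro closed_Collect_all closed_Collect_imp closed_Collect_le open_Collect_const
      continuous_intros)

lemma convex_antitone_vecs: "convex (antitone_vecs :: (real^'n::{finite,linorder}) set)"
  by (auto simp: convex_def antitone_vecs_def intro!: add_mono mult_left_mono)

section \<open>Sums of largest eigenvalues\<close>

lemma quadratic_form_eigenbasis:
  fixes A :: "real^'n^'n"
  assumes "orthonormal u" "\<And>i. A *v u i = (w $ i) *\<^sub>R u i"
  shows "x \<bullet> (A *v x) = (\<Sum>j\<in>UNIV. w $ j * (u j \<bullet> x)\<^sup>2)"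
proof -
  have "A *v x = A *v (\<Sum>j\<in>UNIV. (u j \<bullet> x) *\<^sub>R u j)"
    using orthonormal_expansion[OF assms(1), of x] by simp
  also have "\<dots> = (\<Sum>j\<in>UNIV. (u j \<bullet> x) *\<^sub>R (w $ j) *\<^sub>R u j)"
    by (simp add: linear_sum[OF matrix_vector_mul_linear] matrix_vector_mult_scaleR assms(2))
  finally show ?thesis
    by (simp add: inner_sum_right power2_eq_square inner_commute mult_ac)
qed

text \<open>
  Both sides are the trace of \<open>A\<close>, the left one computed in the basis \<open>q\<close>.
\<close>

lemma sum_quadratic_form_orthonormal:
  fixes A :: "real^('n::_)^('n::{finite,linorder})"
  assumes A: "A \<in> sym_matrices" and q: "orthonormal q"
  shows "(\<Sum>i\<in>UNIV. q i \<bullet> (A *v q i)) = (\<Sum>i\<in>UNIV. ordered_eigenvalues A $ i)"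
proof -
  obtain u where u: "orthonormal u" "\<And>i. A *v u i = (ordered_eigenvalues A $ i) *\<^sub>R u i"
    using ordered_eigenbasis[OF A] by blast
  have "(\<Sum>i\<in>UNIV. q i \<bullet> (A *v q i))
      = (\<Sum>j\<in>UNIV. \<Sum>i\<in>UNIV. ordered_eigenvalues A $ j * (u j \<bullet> q i)\<^sup>2)"
    unfolding quadratic_form_eigenbasis[OF u] by (rule sum.swap)
  also have "\<dots> = (\<Sum>j\<in>UNIV. ordered_eigenvalues A $ j)"
  proof (rule sum.cong[OF refl])
    fix j
    have "(\<Sum>i\<in>UNIV. (u j \<bullet> q i)\<^sup>2) = 1"
      using orthonormal_parseval[OF q, of "u j"] u(1) by (simp add: inner_commute orthonormal_def)
    then show "(\<Sum>i\<in>UNIV. ordered_eigenvalues A $ j * (u j \<bullet> q i)\<^sup>2) = ordered_eigenvalues A $ j"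
      by (simp flip: sum_distrib_left)
  qed
  finally show ?thesis .
qed

text \<open>
  In an eigenbasis \<open>u\<close> the left-hand side is \<open>\<Sum>j. w $ j * c j\<close>, where \<open>c j\<close> is the squared length of
  the projection of \<open>u j\<close> onto the span of the vectors \<open>q i\<close> with \<open>i \<le> k\<close>. The weights \<open>c j\<close> lie between 0
  and 1 and have the same sum as the indicator \<open>d\<close> of \<open>{..k}\<close>. Since \<open>w\<close> is nonincreasing, moving
  all the weight onto \<open>{..k}\<close> does not decrease the weighted sum.
\<close>

lemma ky_fan_inequality:
  fixes A :: "real^('n::_)^('n::{finite,linorder})"
  assumes A: "A \<in> sym_matrices" and q: "orthonormal q"
  shows "(\<Sum>i | i \<le> k. q i \<bullet> (A *v q i)) \<le> (\<Sum>i | i \<le> k. ordered_eigenvalues A $ i)"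
proof -
  define w where "w = ordered_eigenvalues A"
  have w: "w \<in> antitone_vecs" using ordered_eigenvalues_antitone[OF A] by (simp add: w_def)
  obtain u where u: "orthonormal u" "\<And>i. A *v u i = (w $ i) *\<^sub>R u i"
    using ordered_eigenbasis[OF A] by (auto simp: w_def)
  define c where "c j = (\<Sum>i | i \<le> k. (u j \<bullet> q i)\<^sup>2)" for j
  define d where "d j = (if j \<le> k then 1 else 0 :: real)" for j
  have c1: "c j \<le> 1" for j
  proof -
    have "c j \<le> (\<Sum>i\<in>UNIV. (u j \<bullet> q i)\<^sup>2)" unfolding c_def by (intro sum_mono2) auto
    also have "\<dots> = 1"
      using orthonormal_parseval[OF q, of "u j"] u(1) by (simp add: inner_commute orthonormal_def)
    finally show ?thesis .
  qed
  have c0: "0 \<le> c j" for j unfolding c_def by (intro sum_nonneg) simp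
  have "(\<Sum>j\<in>UNIV. c j) = (\<Sum>i | i \<le> k. \<Sum>j\<in>UNIV. (u j \<bullet> q i)\<^sup>2)"
    unfolding c_def by (rule sum.swap)
  also have "\<dots> = (\<Sum>j\<in>UNIV. d j)"
    unfolding orthonormal_parseval[OF u(1)] d_def using q
    by (simp add: orthonormal_def sum.If_cases)
  finally have cd: "(\<Sum>j\<in>UNIV. c j) = (\<Sum>j\<in>UNIV. d j)" .
  have "(\<Sum>i | i \<le> k. q i \<bullet> (A *v q i)) = (\<Sum>j\<in>UNIV. \<Sum>i | i \<le> k. w $ j * (u j \<bullet> q i)\<^sup>2)"
    unfolding quadratic_form_eigenbasis[OF u] by (rule sum.swap)
  also have "\<dots> = (\<Sum>j\<in>UNIV. w $ j * c j)"
    by (simp add: c_def sum_distrib_left)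
  also have "\<dots> = (\<Sum>j\<in>UNIV. w $ j * d j) + (\<Sum>j\<in>UNIV. (w $ j - w $ k) * (c j - d j))"
    using cd
    by (simp add: algebra_simps sum.distrib sum_subtractf) (simp flip: sum_distrib_right)
  also have "(\<Sum>j\<in>UNIV. (w $ j - w $ k) * (c j - d j)) \<le> 0"
  proof (rule sum_nonpos)
    fix j
    show "(w $ j - w $ k) * (c j - d j) \<le> 0"
      using w c0[of j] c1[of j]
      by (cases "j \<le> k") (auto simp: antitone_vecs_def d_def mult_le_0_iff)
  qed
  also have "(\<Sum>j\<in>UNIV. w $ j * d j) + 0 = (\<Sum>i | i \<le> k. w $ i)"
    by (simp add: d_def if_distrib sum.If_cases cong: if_cong)
  finally show ?thesis by (simp add: w_def)
qed

lemma subspace_sym_matrices: "subspace (sym_matrices :: (real^'n^'n) set)"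
  by (auto simp: subspace_def sym_matrices_def transpose_def vec_eq_iff)

section \<open>The epigraph\<close>

text \<open>
  For symmetric \<open>A\<close>, the minimum over orthonormal \<open>q\<close> of the value at \<open>(A, y)\<close> is the partial sum of
  \<open>y - ordered_eigenvalues A\<close> up to \<open>k\<close>. For fixed \<open>q\<close> the value is linear in \<open>(A, y)\<close>, which the
  eigenvalues are not.
\<close>

definition ky_fan_gap ::
    "('n::{finite,linorder} \<Rightarrow> (real, 'n) vec) \<Rightarrow> 'n \<Rightarrow>
      ((real, 'n) vec, 'n) vec \<times> (real, 'n) vec \<Rightarrow> real" where
  "ky_fan_gap q k p = (\<Sum>i | i \<le> k. snd p $ i - q i \<bullet> (fst p *v q i))"

lemma linear_ky_fan_gap: "linear (ky_fan_gap q k)"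
  unfolding ky_fan_gap_def
  by (intro linear_compose_sum ballI)
    (simp add: linear_iff matrix_vector_mult_add_rdistrib inner_add_right algebra_simps
      flip: scaleR_matrix_vector_assoc)

text \<open>
  One inclusion is Ky Fan's inequality; for the other it suffices to take an ordered eigenbasis of
  \<open>A\<close> for \<open>q\<close>, for which equality holds.
\<close>

lemma K_epi_ordered_eigenvalues:
  "K_epi eig_cone sym_matrices (ordered_eigenvalues :: _ \<Rightarrow> real^'n::{finite,linorder}) =
    (sym_matrices \<times> UNIV) \<inter>
    (\<Inter>q\<in>Collect orthonormal. (\<Inter>k. ky_fan_gap q k -` {0..}) \<inter> ky_fan_gap q (Max UNIV) -` {0})"
proof -
  have "y - ordered_eigenvalues A \<in> eig_cone \<longleftrightarrow>
      (\<forall>q. orthonormal q \<longrightarrow> (\<forall>k. 0 \<le> ky_fan_gap q k (A, y)) \<and> ky_fan_gap q (Max UNIV) (A, y) = 0)"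
    (is "?L \<longleftrightarrow> ?R") if A: "A \<in> sym_matrices" for A and y :: "(real, 'n) vec"
  proof
    assume L: ?L
    show ?R
    proof (intro allI impI conjI)
      fix q :: "'n \<Rightarrow> (real, 'n) vec" and k
      assume q: "orthonormal q"
      have "0 \<le> (\<Sum>i | i \<le> k. (y - ordered_eigenvalues A) $ i)"
        using L unfolding eig_cone_iff by blast
      then show "0 \<le> ky_fan_gap q k (A, y)"
        using ky_fan_inequality[OF A q, of k] by (simp add: ky_fan_gap_def sum_subtractf)
      show "ky_fan_gap q (Max UNIV) (A, y) = 0"
        using L sum_quadratic_form_orthonormal[OF A q]
        by (simp add: ky_fan_gap_def eig_cone_iff sum_subtractf atMost_Max_UNIV)
    qed
  next
    assume R: ?R
    obtain u where u: "orthonormal u" "\<And>i. A *v u i = (ordered_eigenvalues A $ i) *\<^sub>R u i"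
      using ordered_eigenbasis[OF A] by blast
    have "u i \<bullet> (A *v u i) = ordered_eigenvalues A $ i" for i
      using u by (simp add: orthonormal_def)
    then have "ky_fan_gap u k (A, y) = (\<Sum>i | i \<le> k. (y - ordered_eigenvalues A) $ i)" for k
      by (simp add: ky_fan_gap_def)
    with R u(1) show ?L
      unfolding eig_cone_iff by (metis atMost_Max_UNIV)
  qed
  then show ?thesis by (auto simp: K_epi_def)
qed

lemma K_convex_ordered_eigenvalues:
  "K_convex eig_cone sym_matrices (ordered_eigenvalues :: _ \<Rightarrow> real^'n::{finite,linorder})"
  unfolding K_convex_def K_epi_ordered_eigenvalues
  by (intro convex_Int convex_INT convex_Times convex_linear_vimage linear_ky_fan_gap
      subspace_imp_convex[OF subspace_sym_matrices]) auto

lemma K_closed_ordered_eigenvalues: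
  "K_closed eig_cone sym_matrices (ordered_eigenvalues :: _ \<Rightarrow> real^'n::{finite,linorder})"
  unfolding K_closed_def K_epi_ordered_eigenvalues
  by (intro closed_Int closed_INT ballI closed_Times closed_vimage linear_continuous_on
      linear_conv_bounded_linear[THEN iffD1] linear_ky_fan_gap closed_subspace[OF subspace_sym_matrices]) auto

section \<open>The closed convex hull of the graph\<close>

text \<open>
  The matrix \<open>\<Sum>j. w $ j * (u j)(u j)\<^sup>T\<close>.
\<close>

definition spectral_matrix :: "('n \<Rightarrow> real^'n) \<Rightarrow> real^'n \<Rightarrow> real^'n^'n" where
  "spectral_matrix u w = (\<chi> a b. \<Sum>j\<in>UNIV. w $ j * (u j $ a * u j $ b))"

lemma spectral_matrix_sym: "spectral_matrix u w \<in> sym_matrices"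
  by (simp add: spectral_matrix_def sym_matrices_def transpose_def vec_eq_iff mult.commute)

lemma spectral_matrix_eigenvector:
  assumes "orthonormal u"
  shows "spectral_matrix u w *v u i = (w $ i) *\<^sub>R u i"
proof -
  have "(spectral_matrix u w *v u i) $ a = ((w $ i) *\<^sub>R u i) $ a" for a
  proof -
    have "(spectral_matrix u w *v u i) $ a
        = (\<Sum>b\<in>UNIV. \<Sum>j\<in>UNIV. w $ j * u j $ a * (u j $ b * u i $ b))"
      by (simp add: spectral_matrix_def matrix_vector_mult_def sum_distrib_left sum_distrib_right mult_ac)
    also have "\<dots> = (\<Sum>j\<in>UNIV. w $ j * u j $ a * (u j \<bullet> u i))"
      by (subst sum.swap) (simp add: inner_vec_def sum_distrib_left)
    also have "\<dots> = w $ i * u i $ a"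
      unfolding assms[unfolded orthonormal_def, rule_format] by (simp add: if_distrib cong: if_cong)
    finally show ?thesis by simp
  qed
  then show ?thesis by (simp add: vec_eq_iff)
qed

lemma gph_subset_K_epi: "0 \<in> K \<Longrightarrow> gph S F \<subseteq> K_epi K S F"
  by (auto simp: gph_def K_epi_def)

lemma closure_hull_gph_subset_K_epi:
  fixes F :: "'a::real_normed_vector \<Rightarrow> 'b::real_normed_vector"
  assumes "0 \<in> K" "K_convex K S F" "K_closed K S F"
  shows "closure (convex hull gph S F) \<subseteq> K_epi K S F"
  using assms
  by (intro closure_minimal hull_minimal gph_subset_K_epi) (auto simp: K_convex_def K_closed_def)

lemma closure_hull_gph_ordered_eigenvalues_antitone:
  "closure (convex hull gph sym_matrices (ordered_eigenvalues :: _ \<Rightarrow> real^'n::{finite,linorder}))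
    \<subseteq> UNIV \<times> antitone_vecs"
  by (intro closure_minimal hull_minimal convex_Times convex_UNIV convex_antitone_vecs closed_Times
      closed_UNIV closed_antitone_vecs) (auto simp: gph_def ordered_eigenvalues_antitone)

text \<open>
  This form of the dimension bound avoids indexing by numbers: the dimension exceeds two exactly when
  some index lies strictly between the extreme ones.
\<close>

lemma card_le_2_iff_extremes:
  "CARD('n::{finite,linorder}) \<le> 2 \<longleftrightarrow> (\<forall>i::'n. i = Min UNIV \<or> i = Max UNIV)"
proof
  assume le: "CARD('n) \<le> 2"
  show "\<forall>i::'n. i = Min UNIV \<or> i = Max UNIV"
  proof (rule ccontr)
    assume "\<not> ?thesis"
    then obtain c :: 'n where "c \<noteq> Min UNIV" "c \<noteq> Max UNIV" by blast
    then have "Min UNIV < c" "c < Max UNIV" by (auto simp: order_less_le)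
    then have "card {Min UNIV, c, Max UNIV} = 3" by (auto simp: card_insert_if)
    moreover have "card {Min UNIV, c, Max UNIV} \<le> CARD('n)" by (intro card_mono) auto
    ultimately show False using le by simp
  qed
next
  assume "\<forall>i::'n. i = Min UNIV \<or> i = Max UNIV"
  then have "(UNIV :: 'n set) \<subseteq> {Min UNIV, Max UNIV}" by blast
  then have "CARD('n) \<le> card {Min UNIV, Max UNIV :: 'n}" by (intro card_mono) auto
  also have "\<dots> \<le> 2" by (simp add: card_insert_if)
  finally show "CARD('n) \<le> 2" .
qed

text \<open>
  If \<open>b\<close> lies strictly between the extreme indices, \<open>axis b 1 - axis (Max UNIV) 1\<close> belongs to the cone
  but increases from the first index to \<open>b\<close>. With at most two indices the cone consists of the vectors
  \<open>(t, - t)\<close> with \<open>t \<ge> 0\<close>, or of zero alone.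
\<close>

lemma eig_cone_subset_antitone_iff:
  "(eig_cone :: (real^'n::{finite,linorder}) set) \<subseteq> antitone_vecs \<longleftrightarrow> CARD('n) \<le> 2"
proof
  assume sub: "(eig_cone :: (real, 'n) vec set) \<subseteq> antitone_vecs"
  show "CARD('n) \<le> 2"
  proof (rule ccontr)
    assume "\<not> CARD('n) \<le> 2"
    then obtain b :: 'n where b: "b \<noteq> Min UNIV" "b \<noteq> Max UNIV"
      unfolding card_le_2_iff_extremes by auto
    have le: "Min UNIV \<le> b" "b \<le> Max UNIV" by auto
    then have "axis b 1 - axis (Max UNIV) 1 \<in> (antitone_vecs :: (real, 'n) vec set)"
      using axis_diff_in_eig_cone sub by blast
    then have "(axis b 1 - axis (Max UNIV) 1 :: (real, 'n) vec) $ b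
        \<le> (axis b 1 - axis (Max UNIV) 1 :: (real, 'n) vec) $ Min UNIV"
      using le unfolding antitone_vecs_def by blast
    moreover have "Min UNIV \<noteq> (Max UNIV :: 'n)" using b le by (metis order_antisym)
    ultimately show False using b by (simp add: axis_def split: if_splits)
  qed
next
  assume "CARD('n) \<le> 2"
  then have extremes: "i = Min UNIV \<or> i = Max UNIV" for i :: 'n
    by (simp add: card_le_2_iff_extremes)
  show "(eig_cone :: (real, 'n) vec set) \<subseteq> antitone_vecs"
  proof
    fix v :: "(real, 'n) vec"
    assume v: "v \<in> eig_cone"
    have "v $ j \<le> v $ i" if "i \<le> j" for i j
    proof (cases "i = j")
      case False
      with that have "i < j" by simp
      then have "i < Max UNIV" "Min UNIV < j"
        by (metis Max_ge UNIV_I finite less_le_trans, metis Min_le UNIV_I finite le_less_trans)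
      then have "i = Min UNIV" "j = Max UNIV"
        using extremes by (metis less_irrefl)+
      then have two: "m = i \<or> m = j" for m using extremes[of m] by simp
      have "m \<le> i \<longleftrightarrow> m = i" for m using two[of m] \<open>i < j\<close> by auto
      then have "{m. m \<le> i} = {i}" by simp
      moreover have "UNIV = {i, j}" using two by blast
      moreover have "0 \<le> (\<Sum>m | m \<le> i. v $ m)" "(\<Sum>m\<in>UNIV. v $ m) = 0"
        using v by (auto simp: eig_cone_iff)
      ultimately have "0 \<le> v $ i" "(\<Sum>m\<in>{i, j}. v $ m) = 0" by simp_all
      then show ?thesis using False by simp
    qed simp
    then show "v \<in> antitone_vecs" by (simp add: antitone_vecs_def)
  qed
qed

text \<open>
  In dimension one the cone is zero and the epigraph is the graph. In dimension two write \<open>w\<close> for the eigenvalues of \<open>A\<close>, \<open>s\<close> for their sum and \<open>z = y - (s/2, s/2)\<close>,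
  which has the form \<open>(t, - t)\<close>. In the eigenbasis of \<open>A\<close>, the matrices with eigenvalues \<open>w + z\<close> and \<open>w - z\<close>
  have midpoint \<open>A\<close>. Membership in the epigraph says that \<open>t\<close> is at least half the spectral gap of \<open>A\<close>, so
  \<open>w + z\<close> is already ordered, while \<open>w - z\<close> is ordered after exchanging its entries. The exchanged
  vector is \<open>(s, s) - w + z\<close>, so the ordered eigenvalue vectors have midpoint \<open>(s/2, s/2) + z = y\<close>.
\<close>

lemma K_epi_subset_hull_gph:
  assumes "CARD('n::{finite,linorder}) \<le> 2"
  shows "K_epi eig_cone sym_matrices (ordered_eigenvalues :: _ \<Rightarrow> real^'n::{finite,linorder})
    \<subseteq> convex hull gph sym_matrices ordered_eigenvalues"
proof safe
  fix A :: "((real, 'n) vec, 'n) vec" and y :: "(real, 'n) vec"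
  assume "(A, y) \<in> K_epi eig_cone sym_matrices ordered_eigenvalues"
  then have A: "A \<in> sym_matrices" and v: "y - ordered_eigenvalues A \<in> eig_cone"
    by (auto simp: K_epi_def)
  define w where "w = ordered_eigenvalues A"
  define a b :: 'n where "a = Min UNIV" and "b = Max UNIV"
  have U': "i = a \<or> i = b" for i
    using assms by (simp add: card_le_2_iff_extremes a_def b_def)
  then have U: "UNIV = {a, b}" by auto
  show "(A, y) \<in> convex hull gph sym_matrices ordered_eigenvalues"
  proof (cases "a = b")
    case True
    have "i \<le> k" for i k :: 'n using U'[of i] U'[of k] True by auto
    then have "y - ordered_eigenvalues A = 0"
      using v by (intro eq_zero_if_partial_sums_zero) (simp add: eig_cone_iff)
    then have "y = ordered_eigenvalues A" by simp
    then show ?thesis using A by (intro hull_inc) (simp add: gph_def)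
  next
    case False
    then have ab: "a < b" by (simp add: a_def b_def order_less_le)
    have sum_U: "(\<Sum>i\<in>UNIV. f i) = f a + f b" for f :: "'n \<Rightarrow> real"
      using False by (simp add: U)
    have "i \<le> a \<longleftrightarrow> i = a" for i using U'[of i] ab by auto
    then have le_a: "{i. i \<le> a} = {a}" by simp
    have wab: "w $ b \<le> w $ a"
      using ordered_eigenvalues_antitone[OF A] ab by (simp add: w_def antitone_vecs_def)
    have "0 \<le> (\<Sum>i | i \<le> a. (y - w) $ i)" "(\<Sum>i\<in>UNIV. (y - w) $ i) = 0"
      using v unfolding eig_cone_iff w_def by blast+
    then have ya: "w $ a \<le> y $ a" and tot: "y $ a + y $ b = w $ a + w $ b"
      by (simp_all add: le_a sum_U)
    obtain u where u: "orthonormal u" "\<And>i. A *v u i = (w $ i) *\<^sub>R u i"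
      using ordered_eigenbasis[OF A] by (auto simp: w_def)
    define z where "z = (\<chi> i. y $ i - (w $ a + w $ b) / 2)"
    \<comment> \<open>The exchange of the two indices, which puts \<open>w - z\<close> in order.\<close>
    define p where "p i = (if i = a then b else a)" for i
    define A1 where "A1 = spectral_matrix u (w + z)"
    define A2 where "A2 = spectral_matrix u (w - z)"
    have antitoneI: "x \<in> antitone_vecs" if "x $ b \<le> x $ a" for x :: "(real, 'n) vec"
    proof -
      have "x $ j \<le> x $ i" if "i \<le> j" for i j
        using \<open>x $ b \<le> x $ a\<close> that U'[of i] U'[of j] ab by auto
      then show ?thesis by (simp add: antitone_vecs_def)
    qed
    have "ordered_eigenvalues A1 = w + z"
      unfolding A1_def
    proof (rule ordered_eigenvalues_eqI[OF u(1) spectral_matrix_eigenvector[OF u(1)]])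
      show "w + z \<in> antitone_vecs" using tot ya wab by (intro antitoneI) (simp add: z_def)
    qed
    then have G1: "(A1, w + z) \<in> gph sym_matrices ordered_eigenvalues"
      by (simp add: gph_def A1_def spectral_matrix_sym)
    have "inj p" by (rule injI) (metis U' p_def)
    have "ordered_eigenvalues A2 = (\<chi> i. (w - z) $ p i)"
    proof (rule ordered_eigenvalues_eqI)
      show "orthonormal (u \<circ> p)" using u(1) \<open>inj p\<close> by (rule orthonormal_comp_inj)
      show "A2 *v (u \<circ> p) i = (\<chi> i. (w - z) $ p i) $ i *\<^sub>R (u \<circ> p) i" for i
        using spectral_matrix_eigenvector[OF u(1), of "w - z" "p i"] by (simp add: A2_def)
      show "(\<chi> i. (w - z) $ p i) \<in> antitone_vecs"
        using tot ya wab False by (intro antitoneI) (simp add: z_def p_def field_simps)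
    qed
    then have G2: "(A2, \<chi> i. (w - z) $ p i) \<in> gph sym_matrices ordered_eigenvalues"
      by (simp add: gph_def A2_def spectral_matrix_sym)
    have "A = (1/2) *\<^sub>R A1 + (1/2) *\<^sub>R A2"
    proof (rule matrix_eqI_orthonormal[OF u(1)])
      fix j
      have "((1/2) *\<^sub>R A1 + (1/2) *\<^sub>R A2) *v u j
          = (1/2) *\<^sub>R (A1 *v u j) + (1/2) *\<^sub>R (A2 *v u j)"
        by (simp add: matrix_vector_mult_add_rdistrib scaleR_matrix_vector_assoc)
      also have "\<dots> = (w $ j) *\<^sub>R u j"
        by (simp add: A1_def A2_def spectral_matrix_eigenvector[OF u(1)] algebra_simps
            flip: scaleR_add_left)
      finally show "A *v u j = ((1/2) *\<^sub>R A1 + (1/2) *\<^sub>R A2) *v u j" by (simp add: u(2))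
    qed
    moreover have "y = (1/2) *\<^sub>R (w + z) + (1/2) *\<^sub>R (\<chi> i. (w - z) $ p i)"
    proof -
      have "y $ i = ((1/2) *\<^sub>R (w + z) + (1/2) *\<^sub>R (\<chi> i. (w - z) $ p i)) $ i" for i
        using U'[of i] tot False by (auto simp: z_def p_def field_simps)
      then show ?thesis by (simp add: vec_eq_iff)
    qed
    ultimately have "(A, y) = (1/2) *\<^sub>R (A1, w + z) + (1/2) *\<^sub>R (A2, \<chi> i. (w - z) $ p i)"
      by simp
    also have "\<dots> \<in> convex hull gph sym_matrices ordered_eigenvalues"
      by (rule convexD[OF convex_convex_hull hull_inc[OF G1] hull_inc[OF G2]]) auto
    finally show ?thesis .
  qed
qed

text \<open>
  The fibre of the epigraph over the zero matrix is the cone itself, and every vector in the closed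
  convex hull of the graph is nonincreasing.
\<close>

lemma K_epi_eq_closure_hull_gph_iff:
  "K_epi eig_cone sym_matrices (ordered_eigenvalues :: _ \<Rightarrow> real^'n::{finite,linorder})
      = closure (convex hull gph sym_matrices ordered_eigenvalues) \<longleftrightarrow> CARD('n) \<le> 2"
proof
  assume eq: "K_epi eig_cone sym_matrices (ordered_eigenvalues :: _ \<Rightarrow> (real, 'n) vec)
      = closure (convex hull gph sym_matrices ordered_eigenvalues)"
  have "ordered_eigenvalues 0 = (0 :: (real, 'n) vec)"
    by (rule ordered_eigenvalues_eqI[OF orthonormal_axis]) (auto simp: antitone_vecs_def)
  then have "(0, v) \<in> K_epi eig_cone sym_matrices ordered_eigenvalues" if "v \<in> eig_cone"
    for v :: "(real, 'n) vec"
    using that subspace_0[OF subspace_sym_matrices] by (simp add: K_epi_def)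
  then have "(eig_cone :: (real, 'n) vec set) \<subseteq> antitone_vecs"
    using closure_hull_gph_ordered_eigenvalues_antitone unfolding eq by blast
  then show "CARD('n) \<le> 2" by (simp add: eig_cone_subset_antitone_iff)
next
  assume "CARD('n) \<le> 2"
  from order_trans[OF K_epi_subset_hull_gph[OF this] closure_subset]
  show "K_epi eig_cone sym_matrices (ordered_eigenvalues :: _ \<Rightarrow> (real, 'n) vec)
      = closure (convex hull gph sym_matrices ordered_eigenvalues)"
    by (intro antisym closure_hull_gph_subset_K_epi K_convex_ordered_eigenvalues
        K_closed_ordered_eigenvalues) (simp_all add: eig_cone_iff)
qed

theorem proposition53:
  shows
    "(closed (eig_cone :: (real^'n::{finite,linorder}) set) \<and>
      convex (eig_cone :: (real, 'n) vec set) \<and>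
      pointed_cone (eig_cone :: (real, 'n) vec set) \<and>
      uminus ` polar (eig_cone :: (real, 'n) vec set) = antitone_vecs)
   \<and> (K_convex eig_cone sym_matrices (ordered_eigenvalues :: _ \<Rightarrow> (real, 'n) vec) \<and>
      K_closed eig_cone sym_matrices (ordered_eigenvalues :: _ \<Rightarrow> (real, 'n) vec))
   \<and> (((eig_cone :: (real, 'n) vec set) \<subseteq> uminus ` polar eig_cone \<longleftrightarrow> CARD('n) \<le> 2) \<and>
      (CARD('n) \<le> 2 \<longleftrightarrow>
        K_epi eig_cone sym_matrices (ordered_eigenvalues :: _ \<Rightarrow> (real, 'n) vec) =
          closure (convex hull (gph sym_matrices ordered_eigenvalues))))"
  unfolding uminus_polar_eig_cone eig_cone_subset_antitone_iff K_epi_eq_closure_hull_gph_iff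
  using closed_eig_cone convex_eig_cone pointed_eig_cone K_convex_ordered_eigenvalues
    K_closed_ordered_eigenvalues by blast

end
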